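(* Let $\mu^{\rm b},\mu^{\rm a}\in\mathcal{P}_1$ with $\mu^{\rm b}\preceq_{\rm cx}\mu^{\rm a}$ and assume that $\mu^{\rm m}=\frac{\mu^{\rm b}+\mu^{\rm a}}{2}$ admits a (Lebesgue) density $\phi^{\rm m}$ that is bounded by $M>0$. Let $h:\mathbb{R}_+\to\mathbb{R}$ be upper semicontinuous with linear growth and bounded (total) variation $V(h)<\infty$. Then $$0\le P(h)-\mu^{\rm m}(h)\le C\sqrt{d(\mu^{\rm b},\mu^{\rm a})},\qquad C=\sqrt{2M}\,V(h),$$ where $P(h)=\sup\{\mu(h):\mu\in\mathcal{P}_1,\ \mu^{\rm b}\preceq_{\rm cx}\mu\preceq_{\rm cx}\mu^{\rm a}\}$.
   Context: $\mathbb{R}_+=[0,\infty)$; $\mathcal{P}_1$ is the set of probability measures on $\mathbb{R}_+$ with finite first moment; $\mu(f)=\int f\,d\mu$. Linear growth: $\sup_x|h(x)|/(1+|x|)<\infty$. $V(h)$ is the total variation of $h$ on $\mathbb{R}_+$. $\mu\preceq_{\rm cx}\nu$ (convex order) means $\mu(\psi)\le\nu(\psi)$ for all continuous convex $\psi:\mathbb{R}_+\to\mathbb{R}$ of linear growth. The bid–ask distance is $d(\mu,\nu)=\frac12(\vec d(\mu,\nu)+\vec d(\nu,\mu))$ with $\vec d(\mu,\nu)=\sup\{\mu(\psi)-\nu(\psi):\psi:\mathbb{R}_+\to\mathbb{R}\text{ convex, }\mathrm{Lip}(\psi)\le1\}$, where $\mathrm{Lip}(\psi)$ is the Lipschitz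 constant. *)

theory Defs
  imports "HOL-Probability.Probability"
begin

text \<open>
  Measures on the half-line have underlying space \<open>{0..}\<close> (not the whole real line), so integrals
  depend on the values of a function on \<open>{0..}\<close> only; a function on the half-line is represented
  by a total function whose values at negative arguments are irrelevant.
\<close>

definition P1 :: "real measure set" where
  "P1 = {\<mu>. prob_space \<mu> \<and> sets \<mu> = sets (restrict_space borel {0..}) \<and> integrable \<mu> (\<lambda>x. x)}"

definition linear_growth :: "(real \<Rightarrow> real) \<Rightarrow> bool" where
  "linear_growth h \<longleftrightarrow> bdd_above ((\<lambda>x. \<bar>h x\<bar> / (1 + \<bar>x\<bar>)) ` {0..})"

definition upper_semicontinuous_on :: "real set \<Rightarrow> (real \<Rightarrow> real) \<Rightarrow> bool" where
  "upper_semicontinuous_on S h \<longleftrightarrow>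
     (\<forall>x\<in>S. \<forall>a. h x < a \<longrightarrow> eventually (\<lambda>y. h y < a) (at x within S))"

text \<open>
  The partition points are \<open>x 0 \<le> \<dots> \<le> x n\<close>; repeated points contribute nothing, and every
  finite partition extends to a monotone sequence by repeating its last point.
\<close>

definition total_variation_on :: "real set \<Rightarrow> (real \<Rightarrow> real) \<Rightarrow> ennreal" where
  "total_variation_on S h =
     (SUP (x, n) \<in> {x :: nat \<Rightarrow> real. mono x \<and> range x \<subseteq> S} \<times> UNIV.
        ennreal (\<Sum>i<n. \<bar>h (x (Suc i)) - h (x i)\<bar>))"

definition cx_le :: "real measure \<Rightarrow> real measure \<Rightarrow> bool"  (infix \<open>\<preceq>cx\<close> 50) where
  "\<mu> \<preceq>cx \<nu> \<longleftrightarrow>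
     (\<forall>\<psi>. continuous_on {0..} \<psi> \<and> convex_on {0..} \<psi> \<and> linear_growth \<psi> \<longrightarrow>
        integral\<^sup>L \<mu> \<psi> \<le> integral\<^sup>L \<nu> \<psi>)"

text \<open>
  The suprema below are taken in the reals; they are over nonempty sets that are bounded above,
  see the lemmas at the end of this theory.
\<close>

definition directed_dist :: "real measure \<Rightarrow> real measure \<Rightarrow> real" where
  "directed_dist \<mu> \<nu> =
     (SUP \<psi> \<in> {\<psi>. convex_on {0..} \<psi> \<and> 1-lipschitz_on {0..} \<psi>}. integral\<^sup>L \<mu> \<psi> - integral\<^sup>L \<nu> \<psi>)"

definition bid_ask_dist :: "real measure \<Rightarrow> real measure \<Rightarrow> real" where
  "bid_ask_dist \<mu> \<nu> = (directed_dist \<mu> \<nu> + directed_dist \<nu> \<mu>) / 2"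

definition upper_price :: "real measure \<Rightarrow> real measure \<Rightarrow> (real \<Rightarrow> real) \<Rightarrow> real" where
  "upper_price \<mu>b \<mu>a h = (SUP \<mu> \<in> {\<mu> \<in> P1. \<mu>b \<preceq>cx \<mu> \<and> \<mu> \<preceq>cx \<mu>a}. integral\<^sup>L \<mu> h)"

text \<open>Only meaningful if both measures have the same measurable sets.\<close>

definition mid_measure :: "real measure \<Rightarrow> real measure \<Rightarrow> real measure" where
  "mid_measure \<mu> \<nu> = measure_of (space \<mu>) (sets \<mu>) (\<lambda>A. (emeasure \<mu> A + emeasure \<nu> A) / 2)"


lemma sets_mid_measure [simp]: "sets (mid_measure \<mu> \<nu>) = sets \<mu>"
  by (simp add: mid_measure_def)

lemma emeasure_mid_measure:
  assumes "sets \<nu> = sets \<mu>" "A \<in> sets \<mu>"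
  shows "emeasure (mid_measure \<mu> \<nu>) A = (emeasure \<mu> A + emeasure \<nu> A) / 2"
proof (rule emeasure_measure_of[OF mid_measure_def])
  show "sets \<mu> \<subseteq> Pow (space \<mu>)" by (rule sets.space_closed)
  show "A \<in> sets (mid_measure \<mu> \<nu>)" using assms by simp
  show "positive (sets (mid_measure \<mu> \<nu>)) (\<lambda>A. (emeasure \<mu> A + emeasure \<nu> A) / 2)"
    by (simp add: positive_def)
  show "countably_additive (sets (mid_measure \<mu> \<nu>)) (\<lambda>A. (emeasure \<mu> A + emeasure \<nu> A) / 2)"
  proof (rule countably_additiveI)
    fix F :: "nat \<Rightarrow> real set"
    assume F: "range F \<subseteq> sets (mid_measure \<mu> \<nu>)" "disjoint_family F"
    then have "(\<Sum>i. emeasure \<mu> (F i)) = emeasure \<mu> (\<Union>i. F i)"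
      "(\<Sum>i. emeasure \<nu> (F i)) = emeasure \<nu> (\<Union>i. F i)"
      using assms(1) by (auto intro!: suminf_emeasure)
    then show "(\<Sum>i. (emeasure \<mu> (F i) + emeasure \<nu> (F i)) / 2) =
        (emeasure \<mu> (\<Union>i. F i) + emeasure \<nu> (\<Union>i. F i)) / 2"
      by (simp add: divide_ennreal_def suminf_add[symmetric])
  qed
qed

lemma space_P1: "\<mu> \<in> P1 \<Longrightarrow> space \<mu> = {0..}"
  unfolding P1_def using sets_eq_imp_space_eq[of \<mu> "restrict_space borel {0..}"]
  by (auto simp: space_restrict_space)

lemma linear_growthD:
  assumes "linear_growth h"
  obtains c where "c \<ge> 0" "\<And>x. x \<ge> 0 \<Longrightarrow> \<bar>h x\<bar> \<le> c * (1 + x)"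
proof -
  obtain c where c: "\<And>x. x \<ge> 0 \<Longrightarrow> \<bar>h x\<bar> / (1 + \<bar>x\<bar>) \<le> c"
    using assms unfolding linear_growth_def bdd_above_def by auto
  have "c \<ge> 0" using c[of 0] by simp
  moreover have "\<bar>h x\<bar> \<le> c * (1 + x)" if "x \<ge> 0" for x
    using c[OF that] that by (simp add: divide_simps split: if_splits)
  ultimately show ?thesis by (rule that)
qed

lemma integrable_P1:
  assumes "\<mu> \<in> P1" "h \<in> borel_measurable \<mu>" "\<And>x. x \<ge> 0 \<Longrightarrow> \<bar>h x\<bar> \<le> c * (1 + x)"
  shows "integrable \<mu> h"
proof -
  interpret prob_space \<mu> using assms(1) by (simp add: P1_def)
  have "integrable \<mu> (\<lambda>x. c * (1 + x))"
    using assms(1) by (intro integrable_mult_right Bochner_Integration.integrable_add) (auto simp: P1_def)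
  then show ?thesis
  proof (rule Bochner_Integration.integrable_bound[OF _ assms(2)])
    show "AE x in \<mu>. norm (h x) \<le> norm (c * (1 + x))"
    proof (rule AE_I2)
      fix x assume "x \<in> space \<mu>"
      then have "x \<ge> 0" using space_P1[OF assms(1)] by simp
      then show "norm (h x) \<le> norm (c * (1 + x))"
        using assms(3)[of x] by simp
    qed
  qed
qed

lemma lipschitz_bound:
  assumes "1-lipschitz_on {0..} \<psi>" "x \<ge> (0::real)"
  shows "\<bar>\<psi> x - \<psi> (0::real) :: real\<bar> \<le> x"
  using lipschitz_onD[OF assms(1), of x 0] assms(2) by (simp add: dist_real_def)

lemma integrable_lipschitz_P1:
  fixes \<psi> :: "real \<Rightarrow> real"
  assumes "\<mu> \<in> P1" "1-lipschitz_on {0..} \<psi>"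
  shows "integrable \<mu> \<psi>"
proof (rule integrable_P1[OF assms(1), where c = "1 + \<bar>\<psi> 0\<bar>"])
  have "\<psi> \<in> borel_measurable (restrict_space borel {0..})"
    by (intro borel_measurable_continuous_on_restrict lipschitz_on_continuous_on[OF assms(2)])
  then show "\<psi> \<in> borel_measurable \<mu>"
    using assms(1) measurable_cong_sets[of \<mu> "restrict_space borel {0..}"] by (auto simp: P1_def)
  fix x :: real assume x: "x \<ge> 0"
  then have "x * \<bar>\<psi> 0\<bar> \<ge> 0" by simp
  then show "\<bar>\<psi> x\<bar> \<le> (1 + \<bar>\<psi> 0\<bar>) * (1 + x)"
    using lipschitz_bound[OF assms(2) x] x unfolding distrib_left distrib_right by (simp only: mult_1 mult_1_right mult.commute)
qed

lemma directed_dist_nonempty: "{\<psi>. convex_on {0..} \<psi> \<and> 1-lipschitz_on {0::real..} \<psi>} \<noteq> {}"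
proof -
  have "convex_on {0..} (\<lambda>x::real. 0) \<and> 1-lipschitz_on {0::real..} (\<lambda>x::real. 0::real)"
    by (auto simp: convex_on_def lipschitz_on_def)
  then show ?thesis by blast
qed

lemma directed_dist_bdd_above:
  assumes "\<mu> \<in> P1" "\<nu> \<in> P1"
  shows "bdd_above ((\<lambda>\<psi>. integral\<^sup>L \<mu> \<psi> - integral\<^sup>L \<nu> \<psi>) `
           {\<psi>. convex_on {0..} \<psi> \<and> 1-lipschitz_on {0..} \<psi>})"
proof (rule bdd_aboveI2)
  fix \<psi> :: "real \<Rightarrow> real"
  assume "\<psi> \<in> {\<psi>. convex_on {0..} \<psi> \<and> 1-lipschitz_on {0..} \<psi>}"
  then have L: "1-lipschitz_on {0..} \<psi>" by simp
  have *: "\<bar>integral\<^sup>L \<rho> \<psi> - \<psi> 0\<bar> \<le> integral\<^sup>L \<rho> (\<lambda>x. x)" if "\<rho> \<in> P1" for \<rho>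
  proof -
    interpret prob_space \<rho> using that by (simp add: P1_def)
    note int = integrable_lipschitz_P1[OF that L]
    have intx: "integrable \<rho> (\<lambda>x. x)" using that by (simp add: P1_def)
    have "integral\<^sup>L \<rho> \<psi> - \<psi> 0 = integral\<^sup>L \<rho> (\<lambda>x. \<psi> x - \<psi> 0)"
      using int by (simp add: prob_space)
    also have "\<bar>\<dots>\<bar> \<le> integral\<^sup>L \<rho> (\<lambda>x. \<bar>\<psi> x - \<psi> 0\<bar>)" by (rule integral_abs_bound)
    also have "\<dots> \<le> integral\<^sup>L \<rho> (\<lambda>x. x)"
      by (rule integral_mono) (use int intx lipschitz_bound[OF L] space_P1[OF that] in auto)
    finally show ?thesis .
  qed
  show "integral\<^sup>L \<mu> \<psi> - integral\<^sup>L \<nu> \<psi> \<le> integral\<^sup>L \<mu> (\<lambda>x. x) + integral\<^sup>L \<nu> (\<lambda>x. x)"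
    using *[OF assms(1)] *[OF assms(2)] by linarith
qed

lemma upper_price_nonempty:
  assumes "\<mu>b \<in> P1" "\<mu>b \<preceq>cx \<mu>a"
  shows "{\<mu> \<in> P1. \<mu>b \<preceq>cx \<mu> \<and> \<mu> \<preceq>cx \<mu>a} \<noteq> {}"
  using assms by (auto simp: cx_le_def)

lemma upper_price_bdd_above:
  assumes "linear_growth h"
  shows "bdd_above ((\<lambda>\<mu>. integral\<^sup>L \<mu> h) ` {\<mu> \<in> P1. \<mu>b \<preceq>cx \<mu> \<and> \<mu> \<preceq>cx \<mu>a})"
proof -
  obtain c where c: "c \<ge> 0" "\<And>x. x \<ge> 0 \<Longrightarrow> \<bar>h x\<bar> \<le> c * (1 + x)"
    using linear_growthD[OF assms] by blast
  have lg: "linear_growth (\<lambda>x. c * (1 + x))"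
    unfolding linear_growth_def using c(1)
    by (intro bdd_aboveI2[where M = c]) (auto simp: abs_mult divide_simps)
  have cv: "convex_on {0..} (\<lambda>x::real. c * (1 + x))"
  proof (rule convex_onI)
    fix t x y :: real
    show "c * (1 + ((1 - t) *\<^sub>R x + t *\<^sub>R y)) \<le> (1 - t) * (c * (1 + x)) + t * (c * (1 + y))"
      by (simp add: algebra_simps)
  qed simp
  have ct: "continuous_on {0..} (\<lambda>x::real. c * (1 + x))" by (intro continuous_intros)
  show ?thesis
  proof (rule bdd_aboveI2)
    fix \<mu> assume "\<mu> \<in> {\<mu> \<in> P1. \<mu>b \<preceq>cx \<mu> \<and> \<mu> \<preceq>cx \<mu>a}"
    then have mu: "\<mu> \<in> P1" "\<mu> \<preceq>cx \<mu>a" by auto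
    interpret prob_space \<mu> using mu(1) by (simp add: P1_def)
    have intx: "integrable \<mu> (\<lambda>x. c * (1 + x))" using mu(1) by (simp add: P1_def)
    have "integral\<^sup>L \<mu> h \<le> integral\<^sup>L \<mu> (\<lambda>x. c * (1 + x))"
    proof (rule integral_mono'[OF intx])
      fix x assume "x \<in> space \<mu>"
      then have "x \<ge> 0" using space_P1[OF mu(1)] by simp
      then show "h x \<le> c * (1 + x)" "0 \<le> c * (1 + x)"
        using c(2)[of x] c(1) by auto
    qed
    also have "\<dots> \<le> integral\<^sup>L \<mu>a (\<lambda>x. c * (1 + x))"
      using mu(2) ct cv lg unfolding cx_le_def by blast
    finally show "integral\<^sup>L \<mu> h \<le> integral\<^sup>L \<mu>a (\<lambda>x. c * (1 + x))" .
  qed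
qed

end

theory Submission
  imports Defs
begin

text \<open>
  Write \<open>m\<close> for the mid measure, \<open>d\<close> for the bid-ask distance and
  \<open>C \<mu> c = \<integral> max 0 (y - c) d\<mu>\<close>. For \<open>\<mu>\<close> between bid and ask in convex order,
  \<open>C \<mu>\<close> and \<open>C m\<close> both lie between the call functions of bid and ask, which differ by at most
  \<open>d\<close>; since \<open>m\<close> is the midpoint, \<open>\<bar>C \<mu> - C m\<bar> \<le> d / 2\<close>. Masses of up-sets are
  compared with difference quotients of \<open>C\<close> of step \<open>s\<close>: for \<open>m\<close> the error is
  at most \<open>M s / 2\<close> by the density bound, and passing from \<open>\<mu>\<close> to \<open>m\<close> costs \<open>d / s\<close>.
  Optimizing over \<open>s\<close> gives \<open>\<bar>\<mu> U - m U\<bar> \<le> sqrt (2 M d)\<close> for every up-set \<open>U\<close>.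
  By the layer-cake formula, a bounded monotone function is integrated with error at most its
  range times this constant, and \<open>h\<close> is a difference of two monotone functions whose ranges
  add up to at most its total variation.
\<close>

section \<open>Integration against the mid measure\<close>

lemma space_mid_measure [simp]: "space (mid_measure \<mu> \<nu>) = space \<mu>"
  by (rule sets_eq_imp_space_eq) simp

text \<open>\<open>mid_measure\<close> is specified through its values on sets, so averaging is
  carried up by induction on measurable functions: indicators, multiples, sums and monotone
  limits.\<close>

lemma nn_integral_mid_measure:
  assumes "sets \<nu> = sets \<mu>" and "f \<in> borel_measurable \<mu>"
  shows "nn_integral (mid_measure \<mu> \<nu>) f = (nn_integral \<mu> f + nn_integral \<nu> f) / 2"
  using assms(2)
proof (induction rule: borel_measurable_induct)
  case (cong f g)
  have "space \<nu> = space \<mu>" using assms(1) by (rule sets_eq_imp_space_eq)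
  with cong(3) have "nn_integral \<mu> f = nn_integral \<mu> g" "nn_integral \<nu> f = nn_integral \<nu> g"
    "nn_integral (mid_measure \<mu> \<nu>) f = nn_integral (mid_measure \<mu> \<nu>) g"
    by (auto intro!: nn_integral_cong)
  with cong(4) show ?case by simp
next
  case (set A)
  then show ?case using assms(1) by (simp add: emeasure_mid_measure)
next
  case (mult u c)
  moreover have "u \<in> borel_measurable \<nu>" "u \<in> borel_measurable (mid_measure \<mu> \<nu>)"
    using mult assms(1) by (simp_all cong: measurable_cong_sets)
  ultimately show ?case
    by (simp add: nn_integral_cmult distrib_left ennreal_times_divide)
next
  case (add u v)
  have m: "u \<in> borel_measurable \<nu>" "u \<in> borel_measurable (mid_measure \<mu> \<nu>)"
     "v \<in> borel_measurable \<nu>" "v \<in> borel_measurable (mid_measure \<mu> \<nu>)"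
    using add assms(1) by (simp_all cong: measurable_cong_sets)
  show ?case
    using add m by (simp add: nn_integral_add divide_ennreal_def algebra_simps)
next
  case (seq U)
  have m: "U i \<in> borel_measurable \<nu>" "U i \<in> borel_measurable (mid_measure \<mu> \<nu>)" for i
    using seq assms(1) by (simp_all cong: measurable_cong_sets)
  have "incseq (\<lambda>i. nn_integral \<mu> (U i))" "incseq (\<lambda>i. nn_integral \<nu> (U i))"
    using seq(3) by (auto simp: incseq_def le_fun_def intro!: nn_integral_mono)
  then have "(SUP i. (nn_integral \<mu> (U i) + nn_integral \<nu> (U i)) / 2)
      = ((SUP i. nn_integral \<mu> (U i)) + (SUP i. nn_integral \<nu> (U i))) / 2"
    by (simp add: SUP_divide_ennreal[symmetric] ennreal_SUP_add)
  with seq m show ?case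
    by (simp add: nn_integral_monotone_convergence_SUP image_comp)
qed

text \<open>Reduction to the positive and negative parts of \<open>f\<close>, whose nonnegative
  integrals are all finite.\<close>

lemma
  fixes f :: "real \<Rightarrow> real"
  assumes "sets \<nu> = sets \<mu>" and "integrable \<mu> f" and "integrable \<nu> f"
  shows integrable_mid_measure: "integrable (mid_measure \<mu> \<nu>) f"
    and integral_mid_measure:
      "integral\<^sup>L (mid_measure \<mu> \<nu>) f = (integral\<^sup>L \<mu> f + integral\<^sup>L \<nu> f) / 2"
proof -
  have m: "f \<in> borel_measurable \<mu>" using assms(2) by auto
  have fin: "(\<integral>\<^sup>+x. ennreal (f x) \<partial>\<mu>) < top" "(\<integral>\<^sup>+x. ennreal (- f x) \<partial>\<mu>) < top"
    "(\<integral>\<^sup>+x. ennreal (f x) \<partial>\<nu>) < top" "(\<integral>\<^sup>+x. ennreal (- f x) \<partial>\<nu>) < top"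
    using assms(2,3) by (auto simp: real_integrable_def less_top)
  have p: "(\<integral>\<^sup>+x. ennreal (f x) \<partial>mid_measure \<mu> \<nu>)
      = ((\<integral>\<^sup>+x. ennreal (f x) \<partial>\<mu>) + (\<integral>\<^sup>+x. ennreal (f x) \<partial>\<nu>)) / 2"
    and n: "(\<integral>\<^sup>+x. ennreal (- f x) \<partial>mid_measure \<mu> \<nu>)
      = ((\<integral>\<^sup>+x. ennreal (- f x) \<partial>\<mu>) + (\<integral>\<^sup>+x. ennreal (- f x) \<partial>\<nu>)) / 2"
    using m by (auto intro!: nn_integral_mid_measure[OF assms(1)])
  have mm: "f \<in> borel_measurable (mid_measure \<mu> \<nu>)"
    using m by (simp cong: measurable_cong_sets)
  show int: "integrable (mid_measure \<mu> \<nu>) f"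
    unfolding real_integrable_def p n using fin mm
    by (auto simp: ennreal_divide_eq_top_iff)
  \<comment> \<open>\<open>enn2real\<close> sends infinity to 0, so additivity can fail without the
    two finiteness conditions.\<close>
  have half: "enn2real ((a + b) / 2) = (enn2real a + enn2real b) / 2" if "a < top" "b < top" for a b
    using that enn2real_plus[OF that] by (cases a; cases b)
      (auto simp: divide_ennreal simp flip: ennreal_plus ennreal_numeral)
  show "integral\<^sup>L (mid_measure \<mu> \<nu>) f = (integral\<^sup>L \<mu> f + integral\<^sup>L \<nu> f) / 2"
    unfolding real_lebesgue_integral_def[OF assms(2)] real_lebesgue_integral_def[OF assms(3)]
      real_lebesgue_integral_def[OF int] p n using fin
    by (simp add: half field_simps)
qed

lemma mid_measure_P1:
  assumes "\<mu> \<in> P1" "\<nu> \<in> P1"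
  shows "mid_measure \<mu> \<nu> \<in> P1"
proof -
  have s: "sets \<nu> = sets \<mu>" using assms by (simp add: P1_def)
  interpret \<mu>: prob_space \<mu> using assms(1) by (simp add: P1_def)
  interpret \<nu>: prob_space \<nu> using assms(2) by (simp add: P1_def)
  have "emeasure (mid_measure \<mu> \<nu>) (space \<mu>) = 1"
    using \<mu>.emeasure_space_1 \<nu>.emeasure_space_1 sets_eq_imp_space_eq[OF s]
    by (simp add: emeasure_mid_measure[OF s sets.top])
  then have "prob_space (mid_measure \<mu> \<nu>)"
    by (intro prob_spaceI) simp
  then show ?thesis
    using assms s by (auto simp: P1_def intro!: integrable_mid_measure)
qed

lemma integrable_continuous_linear_growth_P1:
  assumes "\<mu> \<in> P1" "continuous_on {0..} \<psi>" "linear_growth \<psi>"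
  shows "integrable \<mu> \<psi>"
proof -
  obtain c where c: "\<And>x. x \<ge> 0 \<Longrightarrow> \<bar>\<psi> x\<bar> \<le> c * (1 + x)"
    using linear_growthD[OF assms(3)] by blast
  have "\<psi> \<in> borel_measurable \<mu>"
    using borel_measurable_continuous_on_restrict[OF assms(2)] assms(1)
    by (simp add: P1_def cong: measurable_cong_sets)
  then show ?thesis using integrable_P1[OF assms(1)] c by blast
qed

text \<open>Against every test function the mid integral is the average of the two outer ones. This
  makes the mid measure a competitor in the supremum defining the price, which gives the lower
  bound.\<close>

lemma cx_le_mid_measure:
  assumes "\<mu> \<in> P1" "\<nu> \<in> P1" "\<mu> \<preceq>cx \<nu>"
  shows "\<mu> \<preceq>cx mid_measure \<mu> \<nu>" and "mid_measure \<mu> \<nu> \<preceq>cx \<nu>"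
proof -
  have s: "sets \<nu> = sets \<mu>" using assms by (simp add: P1_def)
  have *: "integral\<^sup>L (mid_measure \<mu> \<nu>) \<psi> = (integral\<^sup>L \<mu> \<psi> + integral\<^sup>L \<nu> \<psi>) / 2"
    if "continuous_on {0..} \<psi>" "linear_growth \<psi>" for \<psi>
    using integrable_continuous_linear_growth_P1[OF _ that] assms(1,2)
    by (intro integral_mid_measure[OF s]) auto
  show "\<mu> \<preceq>cx mid_measure \<mu> \<nu>"
    using assms(3) * unfolding cx_le_def by fastforce
  show "mid_measure \<mu> \<nu> \<preceq>cx \<nu>"
    using assms(3) * unfolding cx_le_def by fastforce
qed

section \<open>Call functions, convex order and the bid-ask distance\<close>

lemma linear_growth_call: "linear_growth (\<lambda>y. max 0 (y - c))"
  unfolding linear_growth_def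
proof (rule bdd_aboveI2)
  fix x :: real assume x: "x \<in> {0..}"
  have "\<bar>c\<bar> * (1 + x) \<ge> \<bar>c\<bar>" using x by (simp add: distrib_left)
  then show "\<bar>max 0 (x - c)\<bar> / (1 + \<bar>x\<bar>) \<le> 1 + \<bar>c\<bar>"
    using x by (simp add: divide_le_eq distrib_right)
qed

lemma convex_on_call: "convex_on {0..} (\<lambda>y::real. max 0 (y - c))"
proof (rule convex_onI)
  fix t x y :: real assume t: "0 < t" "t < 1"
  have "(1 - t) * (x - c) \<le> (1 - t) * max 0 (x - c)" "t * (y - c) \<le> t * max 0 (y - c)"
    using t by (auto intro!: mult_left_mono)
  moreover have "0 \<le> (1 - t) * max 0 (x - c) + t * max 0 (y - c)"
    using t by simp
  moreover have "(1 - t) * x + t * y - c = (1 - t) * (x - c) + t * (y - c)"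
    by (simp add: algebra_simps)
  ultimately show "max 0 ((1 - t) *\<^sub>R x + t *\<^sub>R y - c) \<le> (1 - t) * max 0 (x - c) + t * max 0 (y - c)"
    by simp
qed simp

lemma integrable_call_P1: "\<mu> \<in> P1 \<Longrightarrow> integrable \<mu> (\<lambda>y. max 0 (y - c))"
  by (intro integrable_continuous_linear_growth_P1 linear_growth_call continuous_intros)

lemma cx_le_call:
  assumes "\<mu> \<preceq>cx \<nu>"
  shows "(\<integral>y. max 0 (y - c) \<partial>\<mu>) \<le> (\<integral>y. max 0 (y - c) \<partial>\<nu>)"
proof -
  have "continuous_on {0..} (\<lambda>y. max 0 (y - c))" by (intro continuous_intros)
  then show ?thesis
    using assms linear_growth_call convex_on_call unfolding cx_le_def by blast
qed

text \<open>Both \<open>y\<close> and \<open>- y\<close> are admissible convex test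
  functions.\<close>

lemma cx_le_mean:
  assumes "\<mu> \<preceq>cx \<nu>"
  shows "(\<integral>y. y \<partial>\<mu>) = (\<integral>y. y \<partial>\<nu>)"
proof -
  have lg: "linear_growth (\<lambda>y. y)" "linear_growth (\<lambda>y. - y)"
    by (auto simp: linear_growth_def intro!: bdd_aboveI2[where M = 1])
  have ct: "continuous_on {0..} (\<lambda>y::real. y)" "continuous_on {0..} (\<lambda>y::real. - y)"
    by (intro continuous_intros)+
  have cv: "convex_on {0..} (\<lambda>y::real. y)" "convex_on {0..} (\<lambda>y::real. - y)"
    by (auto simp: convex_on_def)
  have "(\<integral>y. y \<partial>\<mu>) \<le> (\<integral>y. y \<partial>\<nu>)" "(\<integral>y. - y \<partial>\<mu>) \<le> (\<integral>y. - y \<partial>\<nu>)"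
    using assms lg ct cv unfolding cx_le_def by blast+
  then show ?thesis by simp
qed

lemma directed_dist_upper:
  assumes "\<mu> \<in> P1" "\<nu> \<in> P1" "convex_on {0..} \<psi>" "1-lipschitz_on {0..} \<psi>"
  shows "integral\<^sup>L \<mu> \<psi> - integral\<^sup>L \<nu> \<psi> \<le> directed_dist \<mu> \<nu>"
  unfolding directed_dist_def
  using assms(3,4) by (intro cSUP_upper[OF _ directed_dist_bdd_above[OF assms(1,2)]]) simp

lemma directed_dist_nonneg:
  assumes "\<mu> \<in> P1" "\<nu> \<in> P1"
  shows "0 \<le> directed_dist \<mu> \<nu>"
proof -
  have "convex_on {0..} (\<lambda>x::real. 0)" "1-lipschitz_on {0..} (\<lambda>x::real. 0::real)"
    by (auto simp: convex_on_def lipschitz_on_def)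
  from directed_dist_upper[OF assms this] show ?thesis by simp
qed

text \<open>
  The factor gained from \<open>\<bar>y - c\<bar> = 2 max 0 (y - c) - (y - c)\<close> is essential for the constant:
  the first function is 1-Lipschitz, and the affine term cancels since the means agree.
\<close>

lemma call_diff_le_bid_ask_dist:
  assumes "\<mu> \<in> P1" "\<nu> \<in> P1" "\<mu> \<preceq>cx \<nu>"
  shows "(\<integral>y. max 0 (y - c) \<partial>\<nu>) - (\<integral>y. max 0 (y - c) \<partial>\<mu>) \<le> bid_ask_dist \<mu> \<nu>"
proof -
  have lip: "1-lipschitz_on {0..} (\<lambda>y::real. \<bar>y - c\<bar>)"
    by (rule lipschitz_onI) (auto simp: dist_real_def)
  have cv: "convex_on {0..} (\<lambda>y::real. \<bar>y - c\<bar>)"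
    using convex_on_dist[of "{0..}" c] by (simp add: dist_real_def abs_minus_commute)
  have *: "(\<integral>y. \<bar>y - c\<bar> \<partial>\<rho>) = 2 * (\<integral>y. max 0 (y - c) \<partial>\<rho>) - (\<integral>y. y \<partial>\<rho>) + c" if "\<rho> \<in> P1" for \<rho>
  proof -
    interpret prob_space \<rho> using that by (simp add: P1_def)
    have i: "integrable \<rho> (\<lambda>y. y)" using that by (simp add: P1_def)
    have "(\<integral>y. \<bar>y - c\<bar> \<partial>\<rho>) = (\<integral>y. 2 * max 0 (y - c) - y + c \<partial>\<rho>)"
      by (intro Bochner_Integration.integral_cong) (auto simp: max_def)
    also have "\<dots> = 2 * (\<integral>y. max 0 (y - c) \<partial>\<rho>) - (\<integral>y. y \<partial>\<rho>) + c"
      using i integrable_call_P1[OF that] by (simp add: prob_space)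
    finally show ?thesis .
  qed
  show ?thesis
    using directed_dist_upper[OF assms(2,1) cv lip] directed_dist_nonneg[OF assms(1,2)]
      cx_le_mean[OF assms(3)] *[OF assms(1)] *[OF assms(2)]
    unfolding bid_ask_dist_def by argo
qed

section \<open>Bounded densities, call spreads and masses of up-sets\<close>

lemma
  fixes f :: "real \<Rightarrow> real"
  assumes "\<phi> \<in> borel_measurable (restrict_space lborel {0..})"
    and "\<forall>x\<ge>0. \<phi> x \<le> M" and "M \<ge> 0"
    and "\<nu> = density (restrict_space lborel {0..}) (\<lambda>x. ennreal (\<phi> x))"
    and f: "f \<in> borel_measurable borel" "\<forall>x. 0 \<le> f x"
    and c: "(\<integral>\<^sup>+x. ennreal (f x) \<partial>lborel) = ennreal c" "0 \<le> c"
  shows integrable_bounded_density: "integrable \<nu> f"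
    and integral_bounded_density_le: "integral\<^sup>L \<nu> f \<le> M * c"
proof -
  have fm: "f \<in> borel_measurable (restrict_space lborel {0..})"
    using f(1) by (auto intro: measurable_restrict_space1)
  then have fm': "f \<in> borel_measurable \<nu>" by (simp add: assms(4))
  have "(\<integral>\<^sup>+x. ennreal (f x) \<partial>\<nu>) = (\<integral>\<^sup>+x. ennreal (\<phi> x) * ennreal (f x) \<partial>restrict_space lborel {0..})"
    unfolding assms(4) using assms(1) fm by (subst nn_integral_density) auto
  also have "\<dots> \<le> (\<integral>\<^sup>+x. ennreal M * ennreal (f x) \<partial>restrict_space lborel {0..})"
    using assms(2) by (intro nn_integral_mono mult_right_mono ennreal_leI) (auto simp: space_restrict_space)
  also have "\<dots> = (\<integral>\<^sup>+x\<in>{0..}. ennreal M * ennreal (f x) \<partial>lborel)"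
    by (subst nn_integral_restrict_space) auto
  \<comment> \<open>Nonnegativity allows integration over the whole line. The ramps below may start
    at a negative point, so their areas are computed there.\<close>
  also have "\<dots> \<le> (\<integral>\<^sup>+x. ennreal M * ennreal (f x) \<partial>lborel)"
    by (intro nn_integral_mono) (auto split: split_indicator)
  also have "\<dots> = ennreal (M * c)"
    using f(1) assms(3) c by (subst nn_integral_cmult) (auto simp: ennreal_mult)
  finally have le: "(\<integral>\<^sup>+x. ennreal (f x) \<partial>\<nu>) \<le> ennreal (M * c)" .
  show "integrable \<nu> f"
    using le fm' f(2) by (intro integrableI_bounded) (auto simp: le_less_trans)
  show "integral\<^sup>L \<nu> f \<le> M * c"
    using fm' f(2) le assms(3) c(2) by (subst integral_eq_nn_integral) (auto intro: enn2real_leI)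
qed

text \<open>A right triangle of base \<open>s\<close> and height 1. It bounds the error made when a
  call spread replaces a sharp threshold, and its factor 1/2 enters the final constant.\<close>

lemma nn_integral_ramp_up:
  fixes x s :: real
  assumes "s > 0"
  shows "(\<integral>\<^sup>+y. ennreal (indicator {x - s..x} y * ((y - (x - s)) / s)) \<partial>lborel) = ennreal (s / 2)"
proof -
  have "(\<integral>\<^sup>+y. ennreal (indicator {x - s..x} y * ((y - (x - s)) / s)) \<partial>lborel)
      = (\<integral>\<^sup>+y. ennreal ((y - (x - s)) / s) * indicator {x - s..x} y \<partial>lborel)"
    by (intro nn_integral_cong) (auto split: split_indicator)
  also have "\<dots> = ennreal ((x - (x - s))\<^sup>2 / (2 * s) - ((x - s) - (x - s))\<^sup>2 / (2 * s))"
    using assms by (intro nn_integral_FTC_Icc[where F = "\<lambda>y. (y - (x - s))\<^sup>2 / (2 * s)"])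
      (auto intro!: derivative_eq_intros simp: field_simps)
  also have "(x - (x - s))\<^sup>2 / (2 * s) - ((x - s) - (x - s))\<^sup>2 / (2 * s) = s / 2"
    using assms by (simp add: power2_eq_square)
  finally show ?thesis .
qed

lemma nn_integral_ramp_down:
  fixes x s :: real
  assumes "s > 0"
  shows "(\<integral>\<^sup>+y. ennreal (indicator {x..x + s} y * ((x + s - y) / s)) \<partial>lborel) = ennreal (s / 2)"
proof -
  have "(\<integral>\<^sup>+y. ennreal (indicator {x..x + s} y * ((x + s - y) / s)) \<partial>lborel)
      = (\<integral>\<^sup>+y. ennreal ((x + s - y) / s) * indicator {x..x + s} y \<partial>lborel)"
    by (intro nn_integral_cong) (auto split: split_indicator)
  also have "\<dots> = ennreal (- (x + s - (x + s))\<^sup>2 / (2 * s) - (- (x + s - x)\<^sup>2 / (2 * s)))"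
    using assms by (intro nn_integral_FTC_Icc[where F = "\<lambda>y. - (x + s - y)\<^sup>2 / (2 * s)"])
      (auto intro!: derivative_eq_intros simp: field_simps)
  also have "- (x + s - (x + s))\<^sup>2 / (2 * s) - (- (x + s - x)\<^sup>2 / (2 * s)) = s / 2"
    using assms by (simp add: power2_eq_square)
  finally show ?thesis .
qed

text \<open>The call spread is a payoff rising linearly from 0 at \<open>x - s\<close> to 1 at
  \<open>x\<close>, so it dominates the indicator of \<open>{x..}\<close>.\<close>

lemma measure_le_call_spread:
  assumes "\<mu> \<in> P1" "U \<in> sets \<mu>" "U \<subseteq> {x..}" "s > 0"
  shows "measure \<mu> U \<le> ((\<integral>y. max 0 (y - (x - s)) \<partial>\<mu>) - (\<integral>y. max 0 (y - x) \<partial>\<mu>)) / s"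
proof -
  interpret prob_space \<mu> using assms(1) by (simp add: P1_def)
  have U: "integrable \<mu> (indicator U :: real \<Rightarrow> real)"
    using assms(2) by (intro integrable_real_indicator) (auto simp: emeasure_eq_measure)
  have "measure \<mu> U = (\<integral>y. indicator U y \<partial>\<mu>)"
    using assms(2) by simp
  also have "\<dots> \<le> (\<integral>y. (max 0 (y - (x - s)) - max 0 (y - x)) / s \<partial>\<mu>)"
  proof (rule integral_mono)
    fix y
    show "indicator U y \<le> (max 0 (y - (x - s)) - max 0 (y - x)) / s"
      using assms(3,4) by (auto simp: max_def field_simps split: split_indicator)
  qed (use integrable_call_P1[OF assms(1)] U in auto)
  also have "\<dots> = ((\<integral>y. max 0 (y - (x - s)) \<partial>\<mu>) - (\<integral>y. max 0 (y - x) \<partial>\<mu>)) / s"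
    using integrable_call_P1[OF assms(1)] by simp
  finally show ?thesis .
qed

text \<open>Here the ramp starts at \<open>x\<close> and reaches 1 only at \<open>x + s\<close>, so
  on the half-line it stays below the indicator of \<open>{x<..}\<close>.\<close>

lemma measure_ge_call_spread:
  assumes "\<mu> \<in> P1" "U \<in> sets \<mu>" "{0..} \<inter> {x<..} \<subseteq> U" "s > 0"
  shows "((\<integral>y. max 0 (y - x) \<partial>\<mu>) - (\<integral>y. max 0 (y - (x + s)) \<partial>\<mu>)) / s \<le> measure \<mu> U"
proof -
  interpret prob_space \<mu> using assms(1) by (simp add: P1_def)
  have U: "integrable \<mu> (indicator U :: real \<Rightarrow> real)"
    using assms(2) by (intro integrable_real_indicator) (auto simp: emeasure_eq_measure)
  have "((\<integral>y. max 0 (y - x) \<partial>\<mu>) - (\<integral>y. max 0 (y - (x + s)) \<partial>\<mu>)) / s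
      = (\<integral>y. (max 0 (y - x) - max 0 (y - (x + s))) / s \<partial>\<mu>)"
    using integrable_call_P1[OF assms(1)] by simp
  also have "\<dots> \<le> (\<integral>y. indicator U y \<partial>\<mu>)"
  proof (rule integral_mono)
    fix y assume "y \<in> space \<mu>"
    then have "0 \<le> y" using space_P1[OF assms(1)] by simp
    with assms(3) have "y \<notin> U \<Longrightarrow> y \<le> x" by force
    then show "(max 0 (y - x) - max 0 (y - (x + s))) / s \<le> indicator U y"
      using assms(4) by (auto simp: max_def field_simps split: split_indicator)
  qed (use integrable_call_P1[OF assms(1)] U in auto)
  also have "\<dots> = measure \<mu> U"
    using assms(2) by simp
  finally show ?thesis .
qed

text \<open>Converses of the two preceding bounds, up to an error. The ramp and the indicator differ
  by at most a triangle (\<open>u\<close> to the left of \<open>x\<close>, \<open>v\<close> to the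
  right), whose integral is at most \<open>M * s / 2\<close> by the density bound.\<close>

lemma
  assumes "\<nu> \<in> P1"
    and "\<phi> \<in> borel_measurable (restrict_space lborel {0..})"
    and "\<forall>x\<ge>0. \<phi> x \<le> M" and "M \<ge> 0"
    and "\<nu> = density (restrict_space lborel {0..}) (\<lambda>x. ennreal (\<phi> x))"
    and "U \<in> sets \<nu>" "s > 0"
  shows call_spread_le_bounded_density: "{0..} \<inter> {x<..} \<subseteq> U \<Longrightarrow>
      ((\<integral>y. max 0 (y - (x - s)) \<partial>\<nu>) - (\<integral>y. max 0 (y - x) \<partial>\<nu>)) / s \<le> measure \<nu> U + M * s / 2"
    and call_spread_ge_bounded_density: "U \<subseteq> {x..} \<Longrightarrow>
      measure \<nu> U - M * s / 2 \<le> ((\<integral>y. max 0 (y - x) \<partial>\<nu>) - (\<integral>y. max 0 (y - (x + s)) \<partial>\<nu>)) / s"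
proof -
  interpret prob_space \<nu> using assms(1) by (simp add: P1_def)
  define u where "u y = indicator {x - s..x} y * ((y - (x - s)) / s)" for y :: real
  define v where "v y = indicator {x..x + s} y * ((x + s - y) / s)" for y :: real
  note bd = integrable_bounded_density[OF assms(2-5)] integral_bounded_density_le[OF assms(2-5)]
  have u0: "u \<in> borel_measurable borel" "\<forall>y. 0 \<le> u y"
      "(\<integral>\<^sup>+y. ennreal (u y) \<partial>lborel) = ennreal (s / 2)" "0 \<le> s / 2"
    using assms(7) nn_integral_ramp_up[OF assms(7), of x]
    unfolding u_def[abs_def] by (auto split: split_indicator simp del: times_divide_eq_right)
  have u: "integrable \<nu> u" "integral\<^sup>L \<nu> u \<le> M * (s / 2)"
    by (rule bd(1)[OF u0], rule bd(2)[OF u0])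
  have v0: "v \<in> borel_measurable borel" "\<forall>y. 0 \<le> v y"
      "(\<integral>\<^sup>+y. ennreal (v y) \<partial>lborel) = ennreal (s / 2)" "0 \<le> s / 2"
    using assms(7) nn_integral_ramp_down[OF assms(7), of x]
    unfolding v_def[abs_def] by (auto split: split_indicator simp del: times_divide_eq_right)
  have v: "integrable \<nu> v" "integral\<^sup>L \<nu> v \<le> M * (s / 2)"
    by (rule bd(1)[OF v0], rule bd(2)[OF v0])
  have U: "integrable \<nu> (indicator U :: real \<Rightarrow> real)" "(\<integral>y. indicator U y \<partial>\<nu>) = measure \<nu> U"
    using assms(6) by (auto simp: emeasure_eq_measure intro!: integrable_real_indicator)
  note C = integrable_call_P1[OF assms(1)]
  show "((\<integral>y. max 0 (y - (x - s)) \<partial>\<nu>) - (\<integral>y. max 0 (y - x) \<partial>\<nu>)) / s \<le> measure \<nu> U + M * s / 2"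
    if sub: "{0..} \<inter> {x<..} \<subseteq> U"
  proof -
    have "((\<integral>y. max 0 (y - (x - s)) \<partial>\<nu>) - (\<integral>y. max 0 (y - x) \<partial>\<nu>)) / s
        = (\<integral>y. (max 0 (y - (x - s)) - max 0 (y - x)) / s \<partial>\<nu>)"
      using C by simp
    also have "\<dots> \<le> (\<integral>y. indicator U y + u y \<partial>\<nu>)"
    proof (rule integral_mono)
      fix y assume "y \<in> space \<nu>"
      then have "0 \<le> y" using space_P1[OF assms(1)] by simp
      with sub have "y \<notin> U \<Longrightarrow> y \<le> x" by force
      then show "(max 0 (y - (x - s)) - max 0 (y - x)) / s \<le> indicator U y + u y"
        using assms(7) by (auto simp: max_def field_simps u_def split: split_indicator)
    qed (use C u U in auto)
    also have "\<dots> \<le> measure \<nu> U + M * s / 2"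
      using u U by simp
    finally show ?thesis .
  qed
  show "measure \<nu> U - M * s / 2 \<le> ((\<integral>y. max 0 (y - x) \<partial>\<nu>) - (\<integral>y. max 0 (y - (x + s)) \<partial>\<nu>)) / s"
    if sub: "U \<subseteq> {x..}"
  proof -
    have "measure \<nu> U = (\<integral>y. indicator U y \<partial>\<nu>)"
      using U by simp
    also have "\<dots> \<le> (\<integral>y. (max 0 (y - x) - max 0 (y - (x + s))) / s + v y \<partial>\<nu>)"
    proof (rule integral_mono)
      fix y
      show "indicator U y \<le> (max 0 (y - x) - max 0 (y - (x + s))) / s + v y"
        using assms(7) sub by (auto simp: max_def field_simps v_def split: split_indicator)
    qed (use C v U in auto)
    also have "\<dots> = ((\<integral>y. max 0 (y - x) \<partial>\<nu>) - (\<integral>y. max 0 (y - (x + s)) \<partial>\<nu>)) / s + integral\<^sup>L \<nu> v"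
      using C v by simp
    finally show ?thesis
      using v by simp
  qed
qed

text \<open>Minimization of the right-hand side over \<open>s\<close>. For \<open>d = 0\<close> no
  minimizer exists and small \<open>s\<close> are used instead.\<close>

lemma le_sqrt_if_le_linear_plus_inverse:
  fixes a d M :: real
  assumes "M > 0" "d \<ge> 0" "\<And>s. s > 0 \<Longrightarrow> a \<le> M * s / 2 + d / s"
  shows "a \<le> sqrt (2 * M * d)"
proof (cases "d = 0")
  case True
  have "a \<le> 0"
  proof (rule field_le_epsilon)
    fix e :: real assume "e > 0"
    then show "a \<le> 0 + e"
      using assms(3)[of "2 * e / M"] assms(1) True by simp
  qed
  with True show ?thesis by simp
next
  case False
  define r where "r = sqrt (2 * M * d)"
  have r: "r > 0" "r * r = 2 * M * d"
    using False assms(1,2) by (auto simp: r_def)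
  \<comment> \<open>The minimizer \<open>s = r / M\<close> makes both summands equal to
    \<open>r / 2\<close>.\<close>
  have "d / (r / M) = r / 2" "M * (r / M) / 2 = r / 2"
    using r assms(1) by (simp_all add: field_simps)
  then have "a \<le> r"
    using assms(3)[of "r / M"] divide_pos_pos[OF r(1) assms(1)] by linarith
  then show ?thesis by (simp add: r_def)
qed

text \<open>Within the half-line, a nonempty up-set is a ray starting at its infimum, so spreads
  based at that single point control its mass under both laws.\<close>

lemma measure_up_set_diff_le:
  assumes "\<mu> \<in> P1" "\<nu> \<in> P1"
    and "\<phi> \<in> borel_measurable (restrict_space lborel {0..})"
    and "\<forall>x\<ge>0. \<phi> x \<le> M" and "M > 0"
    and "\<nu> = density (restrict_space lborel {0..}) (\<lambda>x. ennreal (\<phi> x))"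
    and call: "\<And>c. \<bar>(\<integral>y. max 0 (y - c) \<partial>\<mu>) - (\<integral>y. max 0 (y - c) \<partial>\<nu>)\<bar> \<le> d / 2"
    and "U \<in> sets \<mu>" and up: "\<And>x y. x \<in> U \<Longrightarrow> x \<le> y \<Longrightarrow> y \<in> U"
  shows "\<bar>measure \<mu> U - measure \<nu> U\<bar> \<le> sqrt (2 * M * d)"
proof (rule le_sqrt_if_le_linear_plus_inverse[OF assms(5)])
  show d: "d \<ge> 0" using call[of 0] by linarith
  fix s :: real assume s: "s > 0"
  show "\<bar>measure \<mu> U - measure \<nu> U\<bar> \<le> M * s / 2 + d / s"
  proof (cases "U = {}")
    case True
    with s d assms(5) show ?thesis by simp
  next
    case False
    have Us: "U \<in> sets \<nu>" using assms(1,2,8) by (simp add: P1_def)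
    have "U \<subseteq> {0..}" using sets.sets_into_space[OF assms(8)] space_P1[OF assms(1)] by simp
    then have bdd: "bdd_below U" by (auto intro: bdd_belowI[of _ 0])
    \<comment> \<open>The infimum may or may not belong to \<open>U\<close>; the inclusions
      \<open>sub\<close> and \<open>sup\<close> cover both cases.\<close>
    define x where "x = Inf U"
    have sub: "U \<subseteq> {x..}" using bdd by (auto simp: x_def intro: cInf_lower)
    have sup: "{0..} \<inter> {x<..} \<subseteq> U"
      using False bdd up by (force simp: x_def cInf_less_iff)
    define c where "c \<rho> t = (\<integral>y. max 0 (y - t) \<partial>\<rho>)" for \<rho> and t :: real
    \<comment> \<open>Two call values enter each quotient, each off by at most \<open>d / 2\<close>,
      hence the total error \<open>d / s\<close>.\<close>
    have cd: "(c \<mu> t - c \<mu> t') / s \<le> (c \<nu> t - c \<nu> t') / s + d / s"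
      "(c \<nu> t - c \<nu> t') / s \<le> (c \<mu> t - c \<mu> t') / s + d / s" for t t'
      using call[of t] call[of t'] s
      unfolding c_def[symmetric] add_divide_distrib[symmetric] abs_le_iff
      by (auto intro!: divide_right_mono)
    have M0: "M \<ge> 0" using assms(5) by simp
    note spread = measure_le_call_spread[OF assms(1,8) sub s]
      measure_ge_call_spread[OF assms(1,8) sup s]
      call_spread_le_bounded_density[OF assms(2,3,4) M0 assms(6) Us s sup]
      call_spread_ge_bounded_density[OF assms(2,3,4) M0 assms(6) Us s sub]
    show ?thesis
      \<comment> \<open>The spread on \<open>[x - s, x]\<close> bounds the mass under
        \<open>\<mu>\<close> from above, the one on \<open>[x, x + s]\<close> from below.\<close>
      using spread cd[of "x - s" x] cd[of x "x + s"] unfolding c_def[symmetric]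
      by linarith
  qed
qed

section \<open>From masses of up-sets to integrals of monotone functions\<close>

lemma (in sigma_finite_measure) nn_integral_layer_cake:
  fixes f :: "'a \<Rightarrow> real"
  assumes [measurable]: "f \<in> borel_measurable M"
    and f: "\<And>x. x \<in> space M \<Longrightarrow> 0 \<le> f x \<and> f x \<le> B"
  shows "(\<integral>\<^sup>+x. ennreal (f x) \<partial>M) = (\<integral>\<^sup>+t\<in>{0..B}. emeasure M {x \<in> space M. t < f x} \<partial>lborel)"
proof -
  interpret pair_sigma_finite M lborel ..
  have "(\<integral>\<^sup>+x. ennreal (f x) \<partial>M)
      = (\<integral>\<^sup>+x. \<integral>\<^sup>+t. indicator {0..B} t * indicator {x \<in> space M. t < f x} x \<partial>lborel \<partial>M)"
  proof (rule nn_integral_cong)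
    fix x assume x: "x \<in> space M"
    have "ennreal (f x) = (\<integral>\<^sup>+t. indicator {0..<f x} t \<partial>lborel)"
      using f[OF x] by simp
    \<comment> \<open>Since \<open>f x \<le> B\<close>, cutting the levels at \<open>B\<close>
      changes nothing; the bounded range of levels is what later makes a constant error per level
      integrable.\<close>
    also have "\<dots> = (\<integral>\<^sup>+t. indicator {0..B} t * indicator {x \<in> space M. t < f x} x \<partial>lborel)"
      using f[OF x] x by (intro nn_integral_cong) (auto split: split_indicator)
    finally show "ennreal (f x) = \<dots>" .
  qed
  also have "\<dots> = (\<integral>\<^sup>+t. \<integral>\<^sup>+x. indicator {0..B} t * indicator {x \<in> space M. t < f x} x \<partial>M \<partial>lborel)"
  proof (rule Fubini'[symmetric])
    show "(\<lambda>(x, t). indicator {0..B} t * indicator {x \<in> space M. t < f x} x :: ennreal)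
        \<in> borel_measurable (M \<Otimes>\<^sub>M lborel)"
      by measurable
  qed
  also have "\<dots> = (\<integral>\<^sup>+t\<in>{0..B}. emeasure M {x \<in> space M. t < f x} \<partial>lborel)"
    by (intro nn_integral_cong) (simp add: nn_integral_cmult mult.commute)
  finally show ?thesis .
qed

lemma integrable_bounded_mono_P1:
  fixes p :: "real \<Rightarrow> real"
  assumes "\<mu> \<in> P1" "mono_on {0..} p" "\<And>x. x \<ge> 0 \<Longrightarrow> 0 \<le> p x \<and> p x \<le> B"
  shows "integrable \<mu> p"
proof -
  interpret prob_space \<mu> using assms(1) by (simp add: P1_def)
  have "p \<in> borel_measurable \<mu>"
    using borel_measurable_mono_on_fnc[OF assms(2)] assms(1)
    by (simp add: P1_def cong: measurable_cong_sets)
  then show ?thesis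
    using assms(3) space_P1[OF assms(1)] by (intro integrable_const_bound[where B = B]) auto
qed

text \<open>Strict superlevel sets of a monotone function are up-sets. Each level costs
  \<open>K\<close>, and the levels fill an interval of length \<open>B\<close>. The hypothesis is
  one-sided so that the two measures can be exchanged.\<close>

lemma integral_mono_diff_le:
  fixes p :: "real \<Rightarrow> real"
  assumes "\<mu> \<in> P1" "\<nu> \<in> P1" "mono_on {0..} p" "\<And>x. x \<ge> 0 \<Longrightarrow> 0 \<le> p x \<and> p x \<le> B"
    and "K \<ge> 0"
    and up: "\<And>U. U \<in> sets \<mu> \<Longrightarrow> (\<And>x y. x \<in> U \<Longrightarrow> x \<le> y \<Longrightarrow> y \<in> U) \<Longrightarrow>
      measure \<mu> U \<le> measure \<nu> U + K"
  shows "integral\<^sup>L \<mu> p \<le> integral\<^sup>L \<nu> p + K * B"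
proof -
  interpret \<mu>: prob_space \<mu> using assms(1) by (simp add: P1_def)
  interpret \<nu>: prob_space \<nu> using assms(2) by (simp add: P1_def)
  have sp: "space \<mu> = {0..}" "space \<nu> = {0..}" using assms(1,2) space_P1 by auto
  have B: "B \<ge> 0" using assms(4)[of 0] by simp
  have int: "integrable \<mu> p" "integrable \<nu> p"
    using integrable_bounded_mono_P1[OF _ assms(3,4)] assms(1,2) by auto
  note [measurable] = int[THEN borel_measurable_integrable]
  have nn: "(\<integral>\<^sup>+x. ennreal (p x) \<partial>\<mu>) = ennreal (integral\<^sup>L \<mu> p)"
    "(\<integral>\<^sup>+x. ennreal (p x) \<partial>\<nu>) = ennreal (integral\<^sup>L \<nu> p)"
    using assms(4) sp int by (auto intro!: nn_integral_eq_integral)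
  have "(\<integral>\<^sup>+x. ennreal (p x) \<partial>\<mu>) = (\<integral>\<^sup>+t\<in>{0..B}. emeasure \<mu> {x \<in> space \<mu>. t < p x} \<partial>lborel)"
    using assms(4) sp by (intro \<mu>.nn_integral_layer_cake) auto
  also have "\<dots> \<le> (\<integral>\<^sup>+t\<in>{0..B}. emeasure \<nu> {x \<in> space \<nu>. t < p x} + ennreal K \<partial>lborel)"
  proof (intro nn_integral_mono mult_right_mono)
    fix t
    have "measure \<mu> {x \<in> space \<mu>. t < p x} \<le> measure \<nu> {x \<in> space \<nu>. t < p x} + K"
      unfolding sp(2) sp(1)[symmetric]
    proof (rule up)
      fix x y assume "x \<in> {x \<in> space \<mu>. t < p x}" "x \<le> y"
      then show "y \<in> {x \<in> space \<mu>. t < p x}"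
        using mono_onD[OF assms(3), of x y] sp by auto
    qed measurable
    then show "emeasure \<mu> {x \<in> space \<mu>. t < p x} \<le> emeasure \<nu> {x \<in> space \<nu>. t < p x} + ennreal K"
      using assms(5) by (simp add: \<mu>.emeasure_eq_measure \<nu>.emeasure_eq_measure flip: ennreal_plus)
  qed simp
  also have "\<dots> = (\<integral>\<^sup>+t. emeasure \<nu> {x \<in> space \<nu>. t < p x} * indicator {0..B} t
      + ennreal K * indicator {0..B} t \<partial>lborel)"
    by (simp add: distrib_right)
  also have "\<dots> = (\<integral>\<^sup>+t\<in>{0..B}. emeasure \<nu> {x \<in> space \<nu>. t < p x} \<partial>lborel)
      + (\<integral>\<^sup>+t. ennreal K * indicator {0..B} t \<partial>lborel)"
    by (rule nn_integral_add) measurable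
  also have "(\<integral>\<^sup>+t. ennreal K * indicator {0..B} t \<partial>lborel) = ennreal (K * B)"
    using B assms(5) by (simp add: nn_integral_cmult_indicator ennreal_mult)
  also have "(\<integral>\<^sup>+t\<in>{0..B}. emeasure \<nu> {x \<in> space \<nu>. t < p x} \<partial>lborel) = (\<integral>\<^sup>+x. ennreal (p x) \<partial>\<nu>)"
    using assms(4) sp by (intro \<nu>.nn_integral_layer_cake[symmetric]) auto
  finally have "ennreal (integral\<^sup>L \<mu> p) \<le> ennreal (integral\<^sup>L \<nu> p) + ennreal (K * B)"
    unfolding nn .
  moreover have "0 \<le> integral\<^sup>L \<nu> p" using assms(4) sp by (intro integral_nonneg_AE) auto
  ultimately show ?thesis
    using B assms(5) by (simp flip: ennreal_plus)
qed

section \<open>Total variation and the Jordan decomposition\<close>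

lemma total_variation_on_mono:
  "A \<subseteq> B \<Longrightarrow> total_variation_on A h \<le> total_variation_on B h"
  unfolding total_variation_on_def by (rule SUP_subset_mono) auto

lemma total_variation_on_upper:
  assumes "mono p" "range p \<subseteq> S"
  shows "ennreal (\<Sum>i<n. \<bar>h (p (Suc i)) - h (p i)\<bar>) \<le> total_variation_on S h"
  unfolding total_variation_on_def using assms by (intro SUP_upper2[of "(p, n)"]) auto

text \<open>Any partition of \<open>{a..x}\<close> can be prolonged by \<open>x\<close> and then
  \<open>y\<close>. This inequality makes both parts of the Jordan decomposition monotone.\<close>

lemma total_variation_on_Icc_add_le:
  assumes "a \<le> x" "x \<le> y"
  shows "total_variation_on {a..x} h + ennreal \<bar>h y - h x\<bar> \<le> total_variation_on {a..y} h"
proof -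
  let ?I = "{p :: nat \<Rightarrow> real. mono p \<and> range p \<subseteq> {a..x}} \<times> (UNIV :: nat set)"
  have "(\<lambda>_. a, 0) \<in> ?I" using assms by (auto simp: mono_def)
  then have ne: "?I \<noteq> {}" by blast
  have "ennreal (\<Sum>i<n. \<bar>h (p (Suc i)) - h (p i)\<bar>) + ennreal \<bar>h y - h x\<bar>
      \<le> total_variation_on {a..y} h" if p: "mono p" "range p \<subseteq> {a..x}" for p n
  proof -
    \<comment> \<open>The new sequence has \<open>n + 2\<close> increments; the middle one, from
      \<open>p n\<close> to \<open>x\<close>, is nonnegative and is dropped.\<close>
    define q where "q i = (if i \<le> n then p i else if i = Suc n then x else y)" for i
    have pax: "a \<le> p i" "p i \<le> x" "p i \<le> y" for i
      using subsetD[OF p(2) rangeI[of p i]] assms(2) by auto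
    have q: "mono q"
      using p(1) pax assms by (auto simp: mono_def q_def)
    have "range q \<subseteq> {a..y}"
      using pax assms by (auto simp: q_def)
    from total_variation_on_upper[OF q this, where n = "n + 2" and h = h]
    have "ennreal ((\<Sum>i<n. \<bar>h (p (Suc i)) - h (p i)\<bar>) + \<bar>h x - h (p n)\<bar> + \<bar>h y - h x\<bar>)
        \<le> total_variation_on {a..y} h"
      by (simp add: q_def)
    moreover have "ennreal (\<Sum>i<n. \<bar>h (p (Suc i)) - h (p i)\<bar>) + ennreal \<bar>h y - h x\<bar>
      \<le> ennreal ((\<Sum>i<n. \<bar>h (p (Suc i)) - h (p i)\<bar>) + \<bar>h x - h (p n)\<bar> + \<bar>h y - h x\<bar>)"
      by (simp add: sum_nonneg flip: ennreal_plus)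
    ultimately show ?thesis by (rule order_trans[rotated])
  qed
  then show ?thesis
    unfolding total_variation_on_def[of "{a..x}"]
    using ne by (subst ennreal_SUP_add_left[symmetric]) (auto intro!: SUP_least)
qed

text \<open>Jordan decomposition by half the sum and half the difference of the variation function
  \<open>T\<close> and \<open>h - h 0\<close>. The delicate point is that the bounds of the two
  parts together cost only one total variation, not two.\<close>

lemma bounded_variation_decomposition:
  assumes "total_variation_on {0..} h < \<infinity>"
  obtains p q :: "real \<Rightarrow> real" and a b :: real where
    "mono_on {0..} p" "mono_on {0..} q"
    "\<And>x. x \<ge> 0 \<Longrightarrow> 0 \<le> p x \<and> p x \<le> a" "\<And>x. x \<ge> 0 \<Longrightarrow> 0 \<le> q x \<and> q x \<le> b"
    "\<And>x. x \<ge> 0 \<Longrightarrow> h x = h 0 + p x - q x"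
    "a + b \<le> enn2real (total_variation_on {0..} h)"
proof -
  let ?V = "enn2real (total_variation_on {0..} h)"
  define T where "T x = enn2real (total_variation_on {0..x} h)" for x :: real
  have fin: "total_variation_on {0..x} h < \<infinity>" for x
    using total_variation_on_mono[of "{0..x}" "{0..}" h] assms by (auto intro: le_less_trans)
  have TV: "T x \<le> ?V" for x
    unfolding T_def using assms by (intro enn2real_mono total_variation_on_mono) auto
  have T: "T x + \<bar>h y - h x\<bar> \<le> T y" if "0 \<le> x" "x \<le> y" for x y
  proof -
    have "ennreal (T x + \<bar>h y - h x\<bar>) \<le> ennreal (T y)"
      using total_variation_on_Icc_add_le[OF that, of h] fin
      by (simp add: T_def ennreal_enn2real)
    then show ?thesis
      unfolding T_def by (subst (asm) ennreal_le_iff) simp_all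
  qed
  define p where "p x = (T x + (h x - h 0)) / 2" for x
  define q where "q x = (T x - (h x - h 0)) / 2" for x
  have mono: "p x \<le> p y" "q x \<le> q y" if "0 \<le> x" "x \<le> y" for x y
    using T[OF that] by (auto simp: p_def q_def)
  have T0: "T 0 \<ge> 0" by (simp add: T_def)
  have nonneg: "0 \<le> p x" "0 \<le> q x" if "0 \<le> x" for x
    using T[of 0 x] that T0 by (auto simp: p_def q_def)
  \<comment> \<open>Different arguments are allowed because the two suprema are to be bounded
    jointly; monotonicity moves both to the larger point, where \<open>p + q = T\<close>.\<close>
  have sum: "p x + q y \<le> ?V" if "0 \<le> x" "0 \<le> y" for x y
  proof -
    have "p x + q y \<le> p (max x y) + q (max x y)"
      using that by (intro add_mono mono) auto
    also have "\<dots> \<le> ?V" using TV[of "max x y"] by (simp add: p_def q_def field_simps)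
    finally show ?thesis .
  qed
  define b where "b = (SUP x\<in>{0..}. q x)"
  have qb: "q x \<le> b" if "0 \<le> x" for x
    unfolding b_def using that sum[of 0] nonneg[of 0]
    by (intro cSUP_upper bdd_aboveI2[where M = ?V]) force+
  have pb: "b \<le> ?V - p x" if "0 \<le> x" for x
    unfolding b_def using sum[OF that] by (intro cSUP_least) (auto simp: algebra_simps)
  show ?thesis
  \<comment> \<open>With \<open>b\<close> the supremum of \<open>q\<close>, the remaining budget
    \<open>?V - b\<close> still bounds \<open>p\<close>.\<close>
  proof (rule that[of p q "?V - b" b])
    show "mono_on {0..} p" "mono_on {0..} q"
      using mono by (auto simp: mono_on_def)
    show "h x = h 0 + p x - q x" if "x \<ge> 0" for x
      by (simp add: p_def q_def field_simps)
  qed (use nonneg qb pb in force)+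
qed

theorem proposition4p6:
  fixes \<mu>b \<mu>a :: "real measure" and \<phi> h :: "real \<Rightarrow> real" and M :: real
  assumes "\<mu>b \<in> P1" and "\<mu>a \<in> P1" and "\<mu>b \<preceq>cx \<mu>a"
    and "M > 0"
    and "\<phi> \<in> borel_measurable (restrict_space lborel {0..})"
    and "\<And>x. x \<ge> 0 \<Longrightarrow> 0 \<le> \<phi> x \<and> \<phi> x \<le> M"
    and "mid_measure \<mu>b \<mu>a = density (restrict_space lborel {0..}) (\<lambda>x. ennreal (\<phi> x))"
    and "upper_semicontinuous_on {0..} h"
    and "linear_growth h"
    and "total_variation_on {0..} h < \<infinity>"
  shows "0 \<le> upper_price \<mu>b \<mu>a h - integral\<^sup>L (mid_measure \<mu>b \<mu>a) h \<and>
         upper_price \<mu>b \<mu>a h - integral\<^sup>L (mid_measure \<mu>b \<mu>a) h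
           \<le> (sqrt (2 * M) * enn2real (total_variation_on {0..} h)) * sqrt (bid_ask_dist \<mu>b \<mu>a)"
proof -
  let ?m = "mid_measure \<mu>b \<mu>a" and ?d = "bid_ask_dist \<mu>b \<mu>a"
  let ?V = "enn2real (total_variation_on {0..} h)" and ?A = "{\<mu> \<in> P1. \<mu>b \<preceq>cx \<mu> \<and> \<mu> \<preceq>cx \<mu>a}"
  have m: "?m \<in> P1" using assms(1,2) by (rule mid_measure_P1)
  have mA: "?m \<in> ?A" using m cx_le_mid_measure[OF assms(1-3)] by simp
  have "integral\<^sup>L ?m h \<le> upper_price \<mu>b \<mu>a h"
    unfolding upper_price_def by (rule cSUP_upper[OF mA upper_price_bdd_above[OF assms(9)]])
  moreover have "upper_price \<mu>b \<mu>a h \<le> integral\<^sup>L ?m h + sqrt (2 * M * ?d) * ?V"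
    unfolding upper_price_def
  proof (rule cSUP_least)
    show "?A \<noteq> {}" using mA by blast
    fix \<mu> assume "\<mu> \<in> ?A"
    then have \<mu>: "\<mu> \<in> P1" "\<mu>b \<preceq>cx \<mu>" "\<mu> \<preceq>cx \<mu>a" by auto
    have sets_eq: "sets ?m = sets \<mu>" using \<mu>(1) m by (simp add: P1_def)
    have call: "\<bar>(\<integral>y. max 0 (y - c) \<partial>\<mu>) - (\<integral>y. max 0 (y - c) \<partial>?m)\<bar> \<le> ?d / 2" for c
    proof -
      have "(\<integral>y. max 0 (y - c) \<partial>?m) = ((\<integral>y. max 0 (y - c) \<partial>\<mu>b) + (\<integral>y. max 0 (y - c) \<partial>\<mu>a)) / 2"
        using assms(1,2) by (intro integral_mid_measure integrable_call_P1) (auto simp: P1_def)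
      then show ?thesis
        using cx_le_call[OF \<mu>(2), of c] cx_le_call[OF \<mu>(3), of c]
          call_diff_le_bid_ask_dist[OF assms(1-3), of c] by argo
    qed
    then have d: "?d \<ge> 0" by (smt (verit) field_sum_of_halves)
    let ?K = "sqrt (2 * M * ?d)"
    have K: "?K \<ge> 0" using d assms(4) by simp
    have up: "\<bar>measure \<mu> U - measure ?m U\<bar> \<le> ?K"
      if "U \<in> sets \<mu>" "\<And>x y. x \<in> U \<Longrightarrow> x \<le> y \<Longrightarrow> y \<in> U" for U
      using assms(6) by (intro measure_up_set_diff_le[OF \<mu>(1) m assms(5) _ assms(4,7) call that]) auto
    obtain p q a b where pq:
      "mono_on {0..} p" "mono_on {0..} q"
      "\<And>x. x \<ge> 0 \<Longrightarrow> 0 \<le> p x \<and> p x \<le> a" "\<And>x. x \<ge> 0 \<Longrightarrow> 0 \<le> q x \<and> q x \<le> b"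
      "\<And>x. x \<ge> 0 \<Longrightarrow> h x = h 0 + p x - q x" "a + b \<le> ?V"
      using bounded_variation_decomposition[OF assms(10)] by blast
    have p: "integral\<^sup>L \<mu> p \<le> integral\<^sup>L ?m p + ?K * a"
      using up by (intro integral_mono_diff_le[OF \<mu>(1) m pq(1,3) K]) (auto simp: abs_le_iff algebra_simps)
    \<comment> \<open>\<open>q\<close> enters \<open>h\<close> with a minus sign, so the comparison
      runs in the opposite direction, with \<open>\<mu>\<close> and the mid measure
      exchanged.\<close>
    have q: "integral\<^sup>L ?m q \<le> integral\<^sup>L \<mu> q + ?K * b"
      using up by (intro integral_mono_diff_le[OF m \<mu>(1) pq(2,4) K, unfolded sets_eq])
        (auto simp: abs_le_iff algebra_simps)
    \<comment> \<open>The constant \<open>h 0\<close> has the same integral under every probability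
      measure and cancels in the comparison.\<close>
    have h: "integral\<^sup>L \<rho> h = h 0 + integral\<^sup>L \<rho> p - integral\<^sup>L \<rho> q" if "\<rho> \<in> P1" for \<rho>
    proof -
      interpret prob_space \<rho> using that by (simp add: P1_def)
      have "integrable \<rho> p" "integrable \<rho> q"
        using integrable_bounded_mono_P1[OF that pq(1,3)] integrable_bounded_mono_P1[OF that pq(2,4)]
        by auto
      moreover have "integral\<^sup>L \<rho> h = integral\<^sup>L \<rho> (\<lambda>x. h 0 + p x - q x)"
        using space_P1[OF that] by (intro Bochner_Integration.integral_cong pq(5)) auto
      ultimately show ?thesis by (simp add: prob_space)
    qed
    have "?K * a + ?K * b \<le> ?K * ?V"
      using mult_left_mono[OF pq(6) K] by (simp add: distrib_left)
    with p q h[OF \<mu>(1)] h[OF m] show "integral\<^sup>L \<mu> h \<le> integral\<^sup>L ?m h + ?K * ?V"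
      by linarith
  qed
  moreover have "sqrt (2 * M * ?d) * ?V = sqrt (2 * M) * ?V * sqrt ?d"
    by (simp add: real_sqrt_mult)
  ultimately show ?thesis by simp
qed

end
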